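(* Let $G=(V,D)$ be an acyclic directed graph, let $A,B\subseteq V$ have the same cardinality $k$ with fixed linear orderings, and let $\mathbf{T}$ be a trek system from $A$ to $B$ without sided intersection. Then the number of trek systems $\mathbf{T}'$ from $A$ to $B$ without sided intersection satisfying $m_{\mathbf{T}'}=m_{\mathbf{T}}$ equals $2^{|\mathrm{UD}(\mathbf{T})|}$.
   Context: $G=(V,D)$ is a finite directed graph without loops or multiple edges; each edge $i\to j$ carries an indeterminate $\lambda_{ij}$ and each vertex $i$ an indeterminate $\omega_{ii}$. A path is a sequence of directed edges where the head of each is the tail of the next (empty paths at a specified vertex allowed). A trek from $i$ to $j$ is a pair $T=(P_L,P_R)$ of directed paths starting at a common vertex $s$, with $P_L$ ending at $i$ and $P_R$ ending at $j$; $m_T=\omega_{ss}\prod_{k\to l\in P_L}\lambda_{kl}\prod_{k\to l\in P_R}\lambda_{kl}$ (with multiplicities). A trek system from $A$ to $B$ is a set of $k$ treks whose initial vertices (ends of left paths) exhaust $A$ and whose final vertices (ends of right paths) exhaust $B$; $m_{\mathbf{T}}=\prod_{T\in\mathbf{T}}m_T$. It has no sided intersection if the left paths are pairwise vertex-disjoint and the right paths are pairwise vertex-disjoint. Up-down cycles: for such $\mathbf{T}$, let $E$ be the set of edges lying in some left path or some right path of $\mathbf{T}$ but not in both a left path and a right path. Define a directed graph $\Gamma$ on vertex set $E$: an edge $e=x\to y\in E$ lying in a left path has an arrow to $f$ if either (i) $y$ lies on some right path and $f=z\to y$ is an edge of a right path entering $y$, or (ii) $y$ lies on no right path (not even as the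 vertex of an empty right path) and $f=y\to z$ is an edge of a left path leaving $y$; otherwise $e$ has no outgoing arrow. An edge $e=x\to y\in E$ lying in a right path has an arrow to $f$ if either (i) $x$ lies on some left path and $f=x\to z$ is an edge of a left path leaving $x$, or (ii) $x$ lies on no left path and $f=z\to x$ is an edge of a right path entering $x$; otherwise no outgoing arrow. An up-down cycle of $\mathbf{T}$ is the edge set (a subset of $E\subseteq D$) supporting a nonempty directed cycle of $\Gamma$; $\mathrm{UD}(\mathbf{T})$ is the set of up-down cycles. *)

theory Defs
  imports "HOL-Library.Poly_Mapping" "Graph_Theory.Pair_Digraph"
begin

datatype 'a indet = Omega 'a | Lambda 'a 'a

text \<open>Polynomials with integer coefficients in the indeterminates \<open>\<omega>\<close> (one per vertex) and
  \<open>\<lambda>\<close> (one per edge): finitely supported maps from exponent vectors to coefficients, with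
  convolution as multiplication.\<close>

type_synonym 'a trek_poly = "('a indet \<Rightarrow>\<^sub>0 nat) \<Rightarrow>\<^sub>0 int"

definition Var :: "'a indet \<Rightarrow> 'a trek_poly" where
  "Var x = Poly_Mapping.single (Poly_Mapping.single x 1) 1"

text \<open>A directed path is a walk in the sense of \<^const>\<open>pre_digraph.awalk\<close>, that is, the list of
  its edges; vertices may repeat and the list may be empty. As the edge list of an empty path does
  not determine its vertex, a trek carries the common starting vertex of its two paths.\<close>

record 'a trek =
  source :: 'a
  left_path :: "('a \<times> 'a) awalk"
  right_path :: "('a \<times> 'a) awalk"

definition is_trek :: "'a pair_pre_digraph \<Rightarrow> 'a \<Rightarrow> 'a trek \<Rightarrow> 'a \<Rightarrow> bool" where
  "is_trek G i T j \<longleftrightarrow>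
     pre_digraph.awalk (with_proj G) (source T) (left_path T) i \<and>
     pre_digraph.awalk (with_proj G) (source T) (right_path T) j"

definition trek_monomial :: "'a trek \<Rightarrow> 'a trek_poly" where
  "trek_monomial T = Var (Omega (source T)) *
     (\<Prod>(k, l)\<leftarrow>left_path T. Var (Lambda k l)) * (\<Prod>(k, l)\<leftarrow>right_path T. Var (Lambda k l))"

definition left_verts :: "'a trek \<Rightarrow> 'a set" where
  "left_verts T = set (pawalk_verts (source T) (left_path T))"

definition right_verts :: "'a trek \<Rightarrow> 'a set" where
  "right_verts T = set (pawalk_verts (source T) (right_path T))"

definition initial_vert :: "'a trek \<Rightarrow> 'a" where
  "initial_vert T = last (pawalk_verts (source T) (left_path T))"

definition final_vert :: "'a trek \<Rightarrow> 'a" where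
  "final_vert T = last (pawalk_verts (source T) (right_path T))"

definition trek_system ::
  "'a pair_pre_digraph \<Rightarrow> nat \<Rightarrow> 'a set \<Rightarrow> 'a set \<Rightarrow> 'a trek set \<Rightarrow> bool" where
  "trek_system G k A B TT \<longleftrightarrow>
     finite TT \<and> card TT = k \<and>
     (\<forall>T\<in>TT. is_trek G (initial_vert T) T (final_vert T)) \<and>
     initial_vert ` TT = A \<and> final_vert ` TT = B"

definition system_monomial :: "'a trek set \<Rightarrow> 'a trek_poly" where
  "system_monomial TT = (\<Prod>T\<in>TT. trek_monomial T)"

definition no_sided_intersection :: "'a trek set \<Rightarrow> bool" where
  "no_sided_intersection TT \<longleftrightarrow>
     (\<forall>S\<in>TT. \<forall>T\<in>TT. S \<noteq> T \<longrightarrow>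
        left_verts S \<inter> left_verts T = {} \<and> right_verts S \<inter> right_verts T = {})"

definition left_edges :: "'a trek set \<Rightarrow> ('a \<times> 'a) set" where
  "left_edges TT = (\<Union>T\<in>TT. set (left_path T))"

definition right_edges :: "'a trek set \<Rightarrow> ('a \<times> 'a) set" where
  "right_edges TT = (\<Union>T\<in>TT. set (right_path T))"

definition one_sided_edges :: "'a trek set \<Rightarrow> ('a \<times> 'a) set" where
  "one_sided_edges TT = (left_edges TT \<union> right_edges TT) - (left_edges TT \<inter> right_edges TT)"

inductive updown_arrow :: "'a trek set \<Rightarrow> 'a \<times> 'a \<Rightarrow> 'a \<times> 'a \<Rightarrow> bool" for TT where
  left_turn:
    "(x, y) \<in> left_edges TT \<Longrightarrow> y \<in> (\<Union>T\<in>TT. right_verts T) \<Longrightarrow>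
     (z, y) \<in> right_edges TT \<Longrightarrow> updown_arrow TT (x, y) (z, y)"
| left_straight:
    "(x, y) \<in> left_edges TT \<Longrightarrow> y \<notin> (\<Union>T\<in>TT. right_verts T) \<Longrightarrow>
     (y, z) \<in> left_edges TT \<Longrightarrow> updown_arrow TT (x, y) (y, z)"
| right_turn:
    "(x, y) \<in> right_edges TT \<Longrightarrow> x \<in> (\<Union>T\<in>TT. left_verts T) \<Longrightarrow>
     (x, z) \<in> left_edges TT \<Longrightarrow> updown_arrow TT (x, y) (x, z)"
| right_straight:
    "(x, y) \<in> right_edges TT \<Longrightarrow> x \<notin> (\<Union>T\<in>TT. left_verts T) \<Longrightarrow>
     (z, x) \<in> right_edges TT \<Longrightarrow> updown_arrow TT (x, y) (z, x)"

text \<open>The vertices of \<open>\<Gamma>\<close> are edges of the original graph, so its arcs are pairs of edges.\<close>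

definition updown_digraph :: "'a trek set \<Rightarrow> ('a \<times> 'a) pair_pre_digraph" where
  "updown_digraph TT =
     \<lparr> pverts = one_sided_edges TT,
       parcs = {(e, f). e \<in> one_sided_edges TT \<and> f \<in> one_sided_edges TT \<and> updown_arrow TT e f} \<rparr>"

text \<open>A cycle \<open>c\<close> of \<open>\<Gamma>\<close> is a nonempty list of arcs of \<open>\<Gamma>\<close>; the tails of these arcs are the
  vertices of \<open>\<Gamma>\<close> on \<open>c\<close>.\<close>

definition UD :: "'a trek set \<Rightarrow> ('a \<times> 'a) set set" where
  "UD TT = {fst ` set c | c. pre_digraph.cycle (with_proj (updown_digraph TT)) c}"

end

theory Submission
  imports Defs
begin

text \<open>
  In an acyclic graph, a trek system without sided intersection is determined by its set of sources
  \<open>S\<close> and the edge sets \<open>L\<close>, \<open>R\<close> of its left and right paths, and the triples that arise are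
  described by local degree conditions at the vertices. The monomial records \<open>S\<close> and the multiset
  union of \<open>L\<close> and \<open>R\<close>, so a second system with the same monomial arises by moving a set \<open>X\<close> of
  one-sided edges to the other side. The degree conditions hold after the move iff \<open>X\<close> is closed under
  the successor relation of \<open>\<Gamma>\<close>. As \<open>\<Gamma>\<close> is a partial injection on a finite set, the closed sets are
  exactly the unions of sets of cycles, and distinct cycles are disjoint.
\<close>

section \<open>Disjoint paths and flows\<close>

lemma pcas_append: "pcas u (p @ q) v \<longleftrightarrow> (\<exists>w. pcas u p w \<and> pcas w q v)"
  by (induction p arbitrary: u) auto

lemma pcas_rtrancl: "pcas u p v \<Longrightarrow> set p \<subseteq> D \<Longrightarrow> (u, v) \<in> D\<^sup>*"
  by (induction p arbitrary: u) (auto intro: converse_rtrancl_into_rtrancl)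

lemma last_pawalk_verts: "pcas u p v \<Longrightarrow> last (pawalk_verts u p) = v"
proof (induction p arbitrary: u)
  case (Cons e p)
  then show ?case by (cases p) auto
qed simp

lemma pawalk_verts_eq_heads: "pcas u p v \<Longrightarrow> pawalk_verts u p = u # map snd p"
  by (induction p arbitrary: u) auto

lemma pawalk_verts_eq_tails: "pcas u p v \<Longrightarrow> pawalk_verts u p = map fst p @ [v]"
  by (induction p arbitrary: u) auto

lemma set_pawalk_verts_heads: "pcas u p v \<Longrightarrow> set (pawalk_verts u p) = insert u (Range (set p))"
  by (simp add: pawalk_verts_eq_heads Range_snd)

lemma set_pawalk_verts_tails: "pcas u p v \<Longrightarrow> set (pawalk_verts u p) = insert v (Domain (set p))"
  by (simp add: pawalk_verts_eq_tails Domain_fst)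

text \<open>If the start recurs later on the walk, the part from the second vertex up to the
  recurrence together with the first edge closes up to a cycle in \<open>D\<close>.\<close>

lemma pcas_distinct_verts:
  assumes "acyclic D" "pcas u p v" "set p \<subseteq> D"
  shows "distinct (pawalk_verts u p)"
  using assms(2,3)
proof (induction p arbitrary: u)
  case (Cons e p)
  have e: "(u, snd e) \<in> D" "pcas (snd e) p v" using Cons.prems by auto
  have "u \<notin> set (pawalk_verts (snd e) p)"
  proof
    assume "u \<in> set (pawalk_verts (snd e) p)"
    then have "u = snd e \<or> (\<exists>x. (x, u) \<in> set p)"
      using set_pawalk_verts_heads[OF e(2)] by auto
    then have "(snd e, u) \<in> D\<^sup>*"
    proof (elim disjE exE)
      fix x assume "(x, u) \<in> set p"
      then obtain q r where "p = q @ (x, u) # r" by (meson split_list)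
      then have "pcas (snd e) (q @ [(x, u)]) u" using e(2) by (auto simp: pcas_append)
      moreover have "set (q @ [(x, u)]) \<subseteq> D" using \<open>p = _\<close> Cons.prems by auto
      ultimately show ?thesis by (rule pcas_rtrancl)
    qed simp
    then have "(u, u) \<in> D\<^sup>+" using e(1) by (rule rtrancl_into_trancl2[rotated])
    then show False using assms(1) by (auto simp: acyclic_def)
  qed
  then show ?case using Cons by auto
qed simp

text \<open>The vertex list is both the start followed by all heads and all tails followed by the
  end. Its distinctness, read in these two ways, yields every claim.\<close>

lemma pcas_acyclic:
  assumes "acyclic D" "pcas u p v" "set p \<subseteq> D"
  shows "distinct p" "single_valued (set p)" "single_valued ((set p)\<inverse>)"
    "u \<notin> Range (set p)" "v \<notin> Domain (set p)"
proof -
  have 1: "distinct (u # map snd p)" "distinct (map fst p @ [v])"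
    using pcas_distinct_verts[OF assms] pawalk_verts_eq_heads[OF assms(2)]
      pawalk_verts_eq_tails[OF assms(2)] by metis+
  then show "distinct p" by (simp add: distinct_map)
  have "inj_on fst (set p)" "inj_on snd (set p)" using 1 by (simp_all add: distinct_map)
  then show "single_valued (set p)" "single_valued ((set p)\<inverse>)"
    by (force simp: single_valued_def inj_on_def)+
  show "u \<notin> Range (set p)" "v \<notin> Domain (set p)"
    using 1 by (simp_all add: Range_snd Domain_fst)
qed

text \<open>For finite acyclic \<open>L\<close>, these local conditions characterize the edge sets
  of vertex-disjoint path families from \<open>S\<close> onto \<open>A\<close>. The last equation is
  conservation: a vertex is started at or entered iff it is ended at or left. Empty paths appear as
  elements of both \<open>S\<close> and \<open>A\<close>.\<close>

definition path_flow :: "'a set \<Rightarrow> 'a set \<Rightarrow> 'a rel \<Rightarrow> bool" where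
  "path_flow S A L \<longleftrightarrow> single_valued L \<and> single_valued (L\<inverse>) \<and>
     S \<inter> Range L = {} \<and> A \<inter> Domain L = {} \<and> S \<union> Range L = A \<union> Domain L"

lemma path_flowD:
  assumes "path_flow S A L"
  shows "\<And>x y z. (x, y) \<in> L \<Longrightarrow> (x, z) \<in> L \<Longrightarrow> y = z"
    and "\<And>x y z. (x, z) \<in> L \<Longrightarrow> (y, z) \<in> L \<Longrightarrow> x = y"
    and "\<And>x y. (x, y) \<in> L \<Longrightarrow> y \<notin> S"
    and "\<And>x y. (x, y) \<in> L \<Longrightarrow> x \<notin> A"
    and "\<And>x. x \<in> S \<or> x \<in> Range L \<longleftrightarrow> x \<in> A \<or> x \<in> Domain L"
  using assms unfolding path_flow_def by (auto simp: single_valued_def)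

text \<open>Each vertex lies on at most one path, so the degree conditions are inherited from the
  single paths. Both sides of the conservation equation are the set of all visited vertices, counted
  once by start and heads and once by end and tails.\<close>

lemma path_flow_Union:
  assumes "acyclic D"
    and paths: "\<And>i. i \<in> I \<Longrightarrow> pcas (s i) (p i) (t i)" "\<And>i. i \<in> I \<Longrightarrow> set (p i) \<subseteq> D"
    and disj: "\<And>i j. i \<in> I \<Longrightarrow> j \<in> I \<Longrightarrow> i \<noteq> j \<Longrightarrow>
      set (pawalk_verts (s i) (p i)) \<inter> set (pawalk_verts (s j) (p j)) = {}"
  shows "path_flow (s ` I) (t ` I) (\<Union>i\<in>I. set (p i))"
proof -
  define V where "V i = set (pawalk_verts (s i) (p i))" for i
  have VH: "V i = insert (s i) (Range (set (p i)))" and VT: "V i = insert (t i) (Domain (set (p i)))"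
    if "i \<in> I" for i
    using set_pawalk_verts_heads[OF paths(1)[OF that]] set_pawalk_verts_tails[OF paths(1)[OF that]]
    unfolding V_def by auto
  note ac = pcas_acyclic[OF assms(1) paths]
  have eqI: "i = j" if "i \<in> I" "j \<in> I" "v \<in> V i" "v \<in> V j" for i j v
    using disj[of i j] that unfolding V_def by blast
  have inV: "x \<in> V i" "y \<in> V i" if "i \<in> I" "(x, y) \<in> set (p i)" for i x y
    using VH[OF that(1)] VT[OF that(1)] that(2) by blast+
  have stV: "s i \<in> V i" "t i \<in> V i" if "i \<in> I" for i
    using VH[OF that] VT[OF that] by blast+
  show ?thesis unfolding path_flow_def
  proof (intro conjI)
    show "single_valued (\<Union>i\<in>I. set (p i))"
      unfolding single_valued_def
      by (auto dest: inV) (metis ac(2) eqI inV(1) single_valuedD)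
    show "single_valued ((\<Union>i\<in>I. set (p i))\<inverse>)"
      unfolding single_valued_def
      by auto (metis ac(3) eqI inV(2) single_valuedD converseI)
    show "s ` I \<inter> Range (\<Union>i\<in>I. set (p i)) = {}"
      using ac(4) eqI inV(2) stV(1) by (auto, metis Range.intros)
    show "t ` I \<inter> Domain (\<Union>i\<in>I. set (p i)) = {}"
      using ac(5) eqI inV(1) stV(2) by (auto, metis Domain.intros)
    have "s ` I \<union> Range (\<Union>i\<in>I. set (p i)) = (\<Union>i\<in>I. V i)" using VH by auto
    moreover have "t ` I \<union> Domain (\<Union>i\<in>I. set (p i)) = (\<Union>i\<in>I. V i)" using VT by auto
    ultimately show "s ` I \<union> Range (\<Union>i\<in>I. set (p i)) = t ` I \<union> Domain (\<Union>i\<in>I. set (p i))"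
      by simp
  qed
qed

text \<open>With out-degree at most one the walk from \<open>u\<close> has no choice, and as no edge
  leaves \<open>A\<close>, neither walk can stop before the other.\<close>

lemma path_flow_path_unique:
  assumes "path_flow S A L"
    and "pcas u p a" "set p \<subseteq> L" "a \<in> A" "pcas u q b" "set q \<subseteq> L" "b \<in> A"
  shows "p = q"
  using assms(2-)
proof (induction p arbitrary: u q)
  case Nil
  then show ?case using path_flowD(4)[OF assms(1)] by (cases q) auto
next
  case (Cons e p)
  show ?case
  proof (cases q)
    case Nil
    then show ?thesis using Cons.prems path_flowD(4)[OF assms(1)] by (cases e) auto
  next
    case (Cons f q')
    have "e = f" using Cons Cons.prems path_flowD(1)[OF assms(1)]
      by (cases e; cases f) auto
    then show ?thesis using Cons Cons.prems Cons.IH[of "snd e" q'] by auto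
  qed
qed

text \<open>The mirror image, traced backwards from \<open>v\<close>: in-degree is at most one and
  no edge enters \<open>S\<close>. This is what keeps paths from different sources disjoint.\<close>

lemma path_flow_source_unique:
  assumes "path_flow S A L"
    and "pcas u p v" "set p \<subseteq> L" "u \<in> S" "pcas w q v" "set q \<subseteq> L" "w \<in> S"
  shows "u = w"
  using assms(2-)
proof (induction p arbitrary: v q rule: rev_induct)
  case Nil
  then show ?case using path_flowD(3)[OF assms(1)]
    by (cases q rule: rev_cases) (auto simp: pcas_append)
next
  case (snoc e p)
  show ?case
  proof (cases q rule: rev_cases)
    case Nil
    then show ?thesis using snoc.prems path_flowD(3)[OF assms(1)]
      by (cases e) (auto simp: pcas_append)
  next
    case (snoc q' f)
    have "e = f" using snoc snoc.prems path_flowD(2)[OF assms(1)]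
      by (cases e; cases f) (auto simp: pcas_append)
    then show ?thesis using snoc snoc.prems snoc.IH[of "fst e" q'] by (auto simp: pcas_append)
  qed
qed

text \<open>Conservation supplies an outgoing edge at every visited vertex outside \<open>A\<close>,
  and a finite acyclic relation can be followed only finitely often.\<close>

lemma path_flow_to_target:
  assumes "path_flow S A L" "finite L" "acyclic L" "v \<in> A \<union> Domain L"
  shows "\<exists>p a. pcas v p a \<and> set p \<subseteq> L \<and> a \<in> A"
proof -
  have "wf (L\<inverse>)" using assms by (rule_tac finite_acyclic_wf_converse)
  then show ?thesis using assms(4)
  proof (induction v)
    case (less v)
    show ?case
    proof (cases "v \<in> A")
      case True
      then show ?thesis by (intro exI[of _ "[]"]) auto
    next
      case False
      then obtain w where w: "(v, w) \<in> L" using less.prems by auto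
      then have "w \<in> A \<union> Domain L" using path_flowD(5)[OF assms(1)] by auto
      then obtain p a where "pcas w p a" "set p \<subseteq> L" "a \<in> A" using less.IH[of w] w by auto
      then show ?thesis using w by (intro exI[of _ "(v, w) # p"]) auto
    qed
  qed
qed

lemma path_flow_from_source:
  assumes "path_flow S A L" "finite L" "acyclic L" "v \<in> S \<union> Range L"
  shows "\<exists>p s. pcas s p v \<and> set p \<subseteq> L \<and> s \<in> S"
proof -
  have "wf L" using assms by (rule_tac finite_acyclic_wf)
  then show ?thesis using assms(4)
  proof (induction v)
    case (less v)
    show ?case
    proof (cases "v \<in> S")
      case True
      then show ?thesis by (intro exI[of _ "[]"]) auto
    next
      case False
      then obtain w where w: "(w, v) \<in> L" using less.prems by auto
      then have "w \<in> S \<union> Range L" using path_flowD(5)[OF assms(1)] by auto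
      then obtain p s where "pcas s p w" "set p \<subseteq> L" "s \<in> S" using less.IH[of w] w by auto
      then show ?thesis using w by (intro exI[of _ "p @ [(w, v)]"]) (auto simp: pcas_append)
    qed
  qed
qed

text \<open>The converse of \<open>path_flow_Union\<close>. Each source gets a walk into
  \<open>A\<close>; by uniqueness every walk in \<open>L\<close> from a source to a target is one of
  these, so targets and edges are all covered.\<close>

lemma path_flow_paths:
  assumes "path_flow S A L" "finite L" "acyclic L"
  obtains p where
    "\<forall>s\<in>S. pcas s (p s) (last (pawalk_verts s (p s)))"
    "(\<lambda>s. last (pawalk_verts s (p s))) ` S = A"
    "(\<Union>s\<in>S. set (p s)) = L"
    "\<forall>s\<in>S. \<forall>t\<in>S. s \<noteq> t \<longrightarrow>
      set (pawalk_verts s (p s)) \<inter> set (pawalk_verts t (p t)) = {}"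
proof -
  have "\<forall>s\<in>S. \<exists>p. (\<exists>a\<in>A. pcas s p a) \<and> set p \<subseteq> L"
    using path_flow_to_target[OF assms] path_flowD(5)[OF assms(1)] by blast
  then obtain p where p: "\<And>s. s \<in> S \<Longrightarrow> \<exists>a\<in>A. pcas s (p s) a" "\<And>s. s \<in> S \<Longrightarrow> set (p s) \<subseteq> L"
    by metis
  define t where "t s = last (pawalk_verts s (p s))" for s
  have t: "t s \<in> A" "pcas s (p s) (t s)" if "s \<in> S" for s
    using p(1)[OF that] last_pawalk_verts unfolding t_def by metis+
  have eq: "q = p s" if "s \<in> S" "pcas s q a" "set q \<subseteq> L" "a \<in> A" for s q a
    using path_flow_path_unique[OF assms(1) that(2-4) t(2)[OF that(1)] p(2)[OF that(1)] t(1)[OF that(1)]] .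
  have "t ` S = A"
  proof
    show "t ` S \<subseteq> A" using t by auto
    show "A \<subseteq> t ` S"
    proof
      fix a assume a: "a \<in> A"
      then have "a \<in> S \<union> Range L" using path_flowD(5)[OF assms(1)] by auto
      then obtain q s where q: "pcas s q a" "set q \<subseteq> L" "s \<in> S"
        using path_flow_from_source[OF assms] by blast
      then have "q = p s" using eq a by auto
      then have "t s = a" using q(1) last_pawalk_verts unfolding t_def by metis
      then show "a \<in> t ` S" using q(3) by auto
    qed
  qed
  moreover have "(\<Union>s\<in>S. set (p s)) = L"
  proof
    show "(\<Union>s\<in>S. set (p s)) \<subseteq> L" using p by auto
    show "L \<subseteq> (\<Union>s\<in>S. set (p s))"
    proof
      fix e assume e: "e \<in> L"
      obtain x y where xy: "e = (x, y)" by (cases e)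
      \<comment> \<open>The edge is prolonged backwards to a source and forwards to a target; the
        resulting walk must be the chosen one.\<close>
      have "x \<in> S \<union> Range L" "y \<in> A \<union> Domain L"
        using path_flowD(5)[OF assms(1)] e xy by blast+
      then obtain q s r a where "pcas s q x" "set q \<subseteq> L" "s \<in> S" "pcas y r a" "set r \<subseteq> L" "a \<in> A"
        using path_flow_from_source[OF assms] path_flow_to_target[OF assms] by meson
      then have "pcas s (q @ e # r) a" "set (q @ e # r) \<subseteq> L" "s \<in> S" "a \<in> A"
        using e xy by (auto simp: pcas_append)
      then have "q @ e # r = p s" using eq by auto
      then show "e \<in> (\<Union>s\<in>S. set (p s))" using \<open>s \<in> S\<close> by (metis UN_I in_set_conv_decomp)
    qed
  qed
  moreover have "set (pawalk_verts s (p s)) \<inter> set (pawalk_verts s' (p s')) = {}"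
    if s: "s \<in> S" "s' \<in> S" "s \<noteq> s'" for s s'
  proof -
    \<comment> \<open>Any vertex of \<open>p s\<close> is reached from \<open>s\<close> within
      \<open>L\<close>, so a common vertex of two paths would trace back to two different
      sources.\<close>
    have pre: "\<exists>q. pcas s q v \<and> set q \<subseteq> L" if "s \<in> S" "v \<in> set (pawalk_verts s (p s))" for s v
    proof -
      have "v = s \<or> (\<exists>x. (x, v) \<in> set (p s))"
        using that set_pawalk_verts_heads[OF t(2)] by auto
      then show ?thesis
      proof (elim disjE exE)
        assume "v = s" then show ?thesis by (intro exI[of _ "[]"]) auto
      next
        fix x assume "(x, v) \<in> set (p s)"
        then obtain q r where *: "p s = q @ (x, v) # r" by (meson split_list)
        then have "pcas s (q @ [(x, v)]) v" using t(2)[OF that(1)] by (auto simp: pcas_append)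
        moreover have "set (q @ [(x, v)]) \<subseteq> L" using p(2)[OF that(1)] * by auto
        ultimately show ?thesis by blast
      qed
    qed
    show ?thesis using pre s path_flow_source_unique[OF assms(1)] by blast
  qed
  ultimately show ?thesis using that t(2) unfolding t_def by blast
qed

section \<open>Moving edges to the other side\<close>

text \<open>The digraph \<open>\<Gamma>\<close> in terms of the sources and the two edge sets. Exchanging the two sides reverses
  all arrows, so the degree conditions after a move need to be checked for one side only.\<close>

definition updown :: "'a set \<Rightarrow> 'a rel \<Rightarrow> 'a rel \<Rightarrow> ('a \<times> 'a) rel" where
  "updown S L R = {(e, f). e \<in> L \<union> R - L \<inter> R \<and> f \<in> L \<union> R - L \<inter> R \<and>
     (e \<in> L \<and> f \<in> R \<and> snd e = snd f \<and> snd e \<in> S \<union> Range R \<or>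
      e \<in> L \<and> f \<in> L \<and> snd e = fst f \<and> snd e \<notin> S \<union> Range R \<or>
      e \<in> R \<and> f \<in> L \<and> fst e = fst f \<and> fst e \<in> S \<union> Range L \<or>
      e \<in> R \<and> f \<in> R \<and> fst e = snd f \<and> fst e \<notin> S \<union> Range L)}"

text \<open>Straight arrows reverse verbatim. For a turn, the reversed arrow requires the shared
  vertex to be visited by the side of the original edge: at a head this edge itself enters it, at a
  tail conservation gives it.\<close>

lemma updown_converse:
  assumes "path_flow S A L" "path_flow S B R"
  shows "(updown S L R)\<inverse> = updown S R L"
proof -
  have "(f, e) \<in> updown S R L" if "path_flow S A L" "path_flow S B R" "(e, f) \<in> updown S L R"
    for S A B :: "'a set" and L R :: "'a rel" and e f
    using that(3) path_flowD(5)[OF that(1)] path_flowD(5)[OF that(2)]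
    unfolding updown_def by (cases e; cases f) (simp, blast)
  from this[OF assms] this[OF assms(2,1)] show ?thesis by auto
qed

text \<open>A one-sided edge lies on one side, the vertex condition then selects one rule, and the
  degree bounds leave at most one candidate for the successor.\<close>

lemma single_valued_updown:
  assumes "path_flow S A L" "path_flow S B R"
  shows "single_valued (updown S L R)"
proof (rule single_valuedI)
  fix e f g assume "(e, f) \<in> updown S L R" "(e, g) \<in> updown S L R"
  then show "f = g"
    using path_flowD(1,2)[OF assms(1)] path_flowD(1,2)[OF assms(2)]
    unfolding updown_def by (cases e; cases f; cases g) (simp, blast)
qed

text \<open>The edges that differ between \<open>L\<close> and \<open>L'\<close> are those that
  change sides. An edge arriving on a side displaces the edge it would collide with; where nothing
  is displaced, conservation forces the adjacent edge of its old side to move along. The edge forced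
  to move is the successor in each case.\<close>

lemma flip_forward:
  assumes "path_flow S A L" "path_flow S B R" "path_flow S A L'" "path_flow S B R'"
    and "L' \<inter> R' = L \<inter> R" "L' \<union> R' = L \<union> R"
    and "e \<in> (L - L') \<union> (L' - L)"
  shows "\<exists>f \<in> (L - L') \<union> (L' - L). (e, f) \<in> updown S L R"
proof -
  obtain x y where e: "e = (x, y)" by (cases e)
  note l = path_flowD[OF assms(1)] and r = path_flowD[OF assms(2)]
    and l' = path_flowD[OF assms(3)] and r' = path_flowD[OF assms(4)]
  have mem: "a \<in> L' \<and> a \<in> R' \<longleftrightarrow> a \<in> L \<and> a \<in> R" "a \<in> L' \<or> a \<in> R' \<longleftrightarrow> a \<in> L \<or> a \<in> R" for a
    using assms(5,6) by auto
  consider (LR) "(x, y) \<in> L" "(x, y) \<notin> R" "(x, y) \<notin> L'" "(x, y) \<in> R'"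
    | (RL) "(x, y) \<in> R" "(x, y) \<notin> L" "(x, y) \<notin> R'" "(x, y) \<in> L'"
    using assms(7) e mem by blast
  then show ?thesis
  proof cases
    case LR
    show ?thesis
    proof (cases "y \<in> S \<union> Range R")
      case True
      then obtain z where z: "(z, y) \<in> R" using l(3)[OF LR(1)] by auto
      then have "(z, y) \<notin> L" using LR l(2) by blast
      moreover have "(z, y) \<in> L'" using mem z LR r'(2) by metis
      ultimately show ?thesis using True LR z e unfolding updown_def
        by (intro bexI[of _ "(z, y)"]) auto
    next
      case False
      \<comment> \<open>Otherwise \<open>L'\<close> needs an edge entering \<open>y\<close>. No edge
        of \<open>R\<close> enters \<open>y\<close>, so it would come from \<open>L\<close> and be
        \<open>(x, y)\<close> itself, which is no longer in \<open>L'\<close>. The same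
        contradiction arises below if \<open>(y, z)\<close> stays in \<open>L'\<close>.\<close>
      have "y \<notin> A"
      proof
        assume "y \<in> A"
        then obtain w where w: "(w, y) \<in> L'" using l'(5)[of y] l(3)[OF LR(1)] by auto
        then have "(w, y) \<in> L" using mem False by blast
        then show False using w LR l(2) by blast
      qed
      then obtain z where z: "(y, z) \<in> L" using l(5)[of y] LR(1) by auto
      have "(y, z) \<notin> R" using False r(5) by blast
      moreover have "(y, z) \<notin> L'"
      proof
        assume "(y, z) \<in> L'"
        then obtain w where w: "(w, y) \<in> L'" using l'(5)[of y] l(3)[OF LR(1)] by auto
        then have "(w, y) \<in> L" using mem False by blast
        then show False using w LR l(2) by blast
      qed
      ultimately show ?thesis using False LR z e unfolding updown_def
        by (intro bexI[of _ "(y, z)"]) auto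
    qed
  next
    case RL
    show ?thesis
    proof (cases "x \<in> S \<union> Range L")
      case True
      then obtain z where z: "(x, z) \<in> L" using l(5)[of x] l'(4)[OF RL(4)] by auto
      then have "(x, z) \<notin> R" using RL r(1) by blast
      moreover have "(x, z) \<notin> L'" using RL z l'(1) by blast
      ultimately show ?thesis using True RL z e unfolding updown_def
        by (intro bexI[of _ "(x, z)"]) auto
    next
      case False
      then obtain z where z: "(z, x) \<in> R" using r(5)[of x] RL(1) by auto
      have "(z, x) \<notin> L" using False by blast
      \<comment> \<open>If it stayed, conservation for \<open>R'\<close> would give an edge of
        \<open>R'\<close> leaving \<open>x\<close>. As \<open>x\<close> is not visited by
        \<open>L\<close>, that edge is in \<open>R\<close> and thus equals \<open>(x, y)\<close>,
        which has left the right side.\<close>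
      moreover have "(z, x) \<notin> R'"
      proof
        assume "(z, x) \<in> R'"
        then obtain w where w: "(x, w) \<in> R'" using r'(5)[of x] r(4)[OF RL(1)] by auto
        then have "(x, w) \<in> R" using mem False l(5) by blast
        then show False using w RL r(1) by blast
      qed
      ultimately show ?thesis using False RL z e mem unfolding updown_def
        by (intro bexI[of _ "(z, x)"]) auto
    qed
  qed
qed

text \<open>Having an arrow makes every edge of \<open>X\<close> one-sided, so the side and the
  vertex condition determine which of the four rules produced its successor.\<close>

lemma closed_updownD:
  assumes "\<forall>e\<in>X. \<exists>f\<in>X. (e, f) \<in> updown S L R" "(x, y) \<in> X"
  shows "(x, y) \<in> L \<Longrightarrow> y \<in> S \<or> y \<in> Range R \<Longrightarrow> \<exists>z. (z, y) \<in> R \<and> (z, y) \<in> X"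
    and "(x, y) \<in> L \<Longrightarrow> \<not> (y \<in> S \<or> y \<in> Range R) \<Longrightarrow> \<exists>z. (y, z) \<in> L \<and> (y, z) \<in> X"
    and "(x, y) \<in> R \<Longrightarrow> x \<in> S \<or> x \<in> Range L \<Longrightarrow> \<exists>z. (x, z) \<in> L \<and> (x, z) \<in> X"
    and "(x, y) \<in> R \<Longrightarrow> \<not> (x \<in> S \<or> x \<in> Range L) \<Longrightarrow> \<exists>z. (z, x) \<in> R \<and> (z, x) \<in> X"
proof -
  obtain u v where uv: "(u, v) \<in> X" "((x, y), (u, v)) \<in> updown S L R"
    using assms by fast
  {
    assume "(x, y) \<in> L" "y \<in> S \<or> y \<in> Range R"
    then have "(u, v) \<in> R" "v = y" using uv(2) unfolding updown_def by auto
    then show "\<exists>z. (z, y) \<in> R \<and> (z, y) \<in> X" using uv(1) by blast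
  next
    assume "(x, y) \<in> L" "\<not> (y \<in> S \<or> y \<in> Range R)"
    then have "(u, v) \<in> L" "u = y" using uv(2) unfolding updown_def by auto
    then show "\<exists>z. (y, z) \<in> L \<and> (y, z) \<in> X" using uv(1) by blast
  next
    assume "(x, y) \<in> R" "x \<in> S \<or> x \<in> Range L"
    then have "(u, v) \<in> L" "u = x" using uv(2) unfolding updown_def by auto
    then show "\<exists>z. (x, z) \<in> L \<and> (x, z) \<in> X" using uv(1) by blast
  next
    assume "(x, y) \<in> R" "\<not> (x \<in> S \<or> x \<in> Range L)"
    then have "(u, v) \<in> R" "v = x" using uv(2) unfolding updown_def by auto
    then show "\<exists>z. (z, x) \<in> R \<and> (z, x) \<in> X" using uv(1) by blast
  }
qed

text \<open>Forward closure under the arrows, and backward closure read as forward closure with the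
  sides exchanged, compensate at every vertex for the edges that leave or join the left side. The
  right side follows by exchanging \<open>L\<close> and \<open>R\<close>.\<close>

lemma path_flow_flip:
  assumes "path_flow S A L" "path_flow S B R"
    and X: "X \<subseteq> L \<union> R - L \<inter> R"
    and fw: "\<forall>e\<in>X. \<exists>f\<in>X. (e, f) \<in> updown S L R"
    and bw: "\<forall>f\<in>X. \<exists>e\<in>X. (e, f) \<in> updown S L R"
  shows "path_flow S A ((L - X) \<union> (R \<inter> X))"
proof -
  note l = path_flowD[OF assms(1)] and r = path_flowD[OF assms(2)]
  note fwd = closed_updownD[OF fw]
  have "\<forall>f\<in>X. \<exists>e\<in>X. (f, e) \<in> updown S R L"
    using bw updown_converse[OF assms(1,2)] by blast
  note bwd = closed_updownD[OF this]
  let ?L = "(L - X) \<union> (R \<inter> X)"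
  \<comment> \<open>The premises conflict: a right edge moving over at \<open>y\<close> forces the
    left edge entering \<open>y\<close> to move away. The equation is the form that
    single-valuedness asks for; \<open>out_deg\<close> is the same at tails.\<close>
  have in_deg: "x = x'" if "(x, y) \<in> L - X" "(x', y) \<in> R \<inter> X" for x x' y
    using that bwd(1)[of x' y] l(2) by blast
  have out_deg: "y = y'" if "(x, y) \<in> L - X" "(x, y') \<in> R \<inter> X" for x y y'
    using that fwd(3)[of x y'] l(1) l(5)[of x] by blast
  show ?thesis unfolding path_flow_def
  proof (intro conjI)
    show "single_valued ?L"
      unfolding single_valued_def using out_deg l(1) r(1) by blast
    show "single_valued (?L\<inverse>)"
      unfolding single_valued_def using in_deg l(2) r(2) by blast
    show "S \<inter> Range ?L = {}" using l(3) r(3) by blast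
    show "A \<inter> Domain ?L = {}"
    proof -
      have False if "x \<in> A" "(x, y) \<in> R" "(x, y) \<in> X" for x y
        using fwd(3)[OF that(3,2)] l(4,5) that(1) by blast
      then show ?thesis using l(4) by blast
    qed
    show "S \<union> Range ?L = A \<union> Domain ?L"
    proof
      \<comment> \<open>If the left edge leaving \<open>y\<close> moves away, backward closure
        brings a right edge leaving \<open>y\<close> in its place; \<open>inn\<close> below is the
        dual for entering edges.\<close>
      have out: "y \<in> A \<union> Domain ?L" if "(y, z) \<in> L" "y \<in> S \<or> y \<in> Range R" for y z
        using bwd(3)[of y z] that by blast
      show "S \<union> Range ?L \<subseteq> A \<union> Domain ?L"
      proof (intro subsetI, elim UnE RangeE)
        fix y assume "y \<in> S"
        then show "y \<in> A \<union> Domain ?L" using l(5)[of y] out by blast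
      next
        fix x y assume xy: "(x, y) \<in> L - X"
        \<comment> \<open>A left edge leaving \<open>y\<close> stays, or is replaced as in
          \<open>out\<close>, or \<open>y\<close> is off the right side; in the last case moving it
          would force \<open>(x, y)\<close> to move as well.\<close>
        then have "y \<in> A \<or> (\<exists>z. (y, z) \<in> L)" using l(5) by blast
        then show "y \<in> A \<union> Domain ?L"
          using xy out bwd(4)[of y] l(2) by (metis DiffD1 DiffD2 DiffI Domain.DomainI UnCI)
      next
        fix x y assume xy: "(x, y) \<in> R \<inter> X"
        show "y \<in> A \<union> Domain ?L"
        proof (cases "y \<in> S \<or> y \<in> Range L")
          case True
          then show ?thesis using l(5)[of y] out xy by blast
        next
          case False
          then show ?thesis using bwd(2)[of x y] xy by blast
        qed
      qed
      have inn: "y \<in> S \<union> Range ?L" if "(z, y) \<in> L" "y \<in> S \<or> y \<in> Range R" for y z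
        using fwd(1)[of z y] that by blast
      show "A \<union> Domain ?L \<subseteq> S \<union> Range ?L"
      proof (intro subsetI, elim UnE DomainE)
        fix y assume y: "y \<in> A"
        then have "y \<in> S \<or> (\<exists>z. (z, y) \<in> L)" using l(5)[of y] by blast
        then show "y \<in> S \<union> Range ?L" using inn fwd(2)[of _ y] l(4) y by blast
      next
        fix x y assume xy: "(x, y) \<in> L - X"
        then have "x \<in> S \<or> (\<exists>z. (z, x) \<in> L)" using l(5)[of x] by blast
        then show "x \<in> S \<union> Range ?L"
          using xy inn fwd(2)[of _ x] l(1) by (metis DiffD1 DiffD2 DiffI Range.intros UnCI)
      next
        fix x y assume xy: "(x, y) \<in> R \<inter> X"
        show "x \<in> S \<union> Range ?L"
        proof (cases "x \<in> S \<or> x \<in> Range L")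
          case True
          moreover have "x \<in> S \<or> x \<in> Range R" using xy fwd(3)[of x y] True r(5)[of x] by blast
          ultimately show ?thesis using inn by blast
        next
          case False
          then show ?thesis using fwd(4)[of x y] xy by blast
        qed
      qed
    qed
  qed
qed

section \<open>Cycles of a partial injection\<close>

text \<open>Choosing successors gives an injective self-map of a finite set, which is therefore
  surjective.\<close>

lemma closed_under_injection_backward:
  assumes "finite X" "single_valued r" "single_valued (r\<inverse>)"
    and "\<And>e. e \<in> X \<Longrightarrow> \<exists>f\<in>X. (e, f) \<in> r"
    and "f \<in> X"
  shows "\<exists>e\<in>X. (e, f) \<in> r"
proof -
  obtain g where g: "\<And>e. e \<in> X \<Longrightarrow> g e \<in> X \<and> (e, g e) \<in> r" using assms(4) by metis
  have "inj_on g X"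
    using g assms(3) by (metis converseI inj_onI single_valuedD)
  then have "f \<in> g ` X" using g assms(1,5) by (subst endo_inj_surj) auto
  then show ?thesis using g by auto
qed

text \<open>With unique successors, following arcs from a cycle never leaves it. Hence a cycle's
  support is determined by any one of its elements, and different supports are disjoint.\<close>

lemma (in pair_wf_digraph) cycle_tails_eq_reachable:
  assumes "cycle c" "e \<in> fst ` set c" "single_valued (parcs G)"
  shows "fst ` set c = (parcs G)\<^sup>* `` {e}"
proof -
  obtain u where u: "pcas u c u" "set c \<subseteq> parcs G" "c \<noteq> []"
    using assms(1) unfolding cycle_def awalk_def by auto
  \<comment> \<open>Start and end coincide, so the tails of the arcs and their heads form the same
    set.\<close>
  have "u \<in> Domain (set c)" using u(1,3) by (cases c) auto
  moreover have "u \<in> Range (set c)"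
    using u(1,3) by (cases c rule: rev_cases) (auto simp: pcas_append)
  ultimately have DR: "Domain (set c) = Range (set c)"
    using set_pawalk_verts_heads[OF u(1)] set_pawalk_verts_tails[OF u(1)] by (simp add: insert_absorb)
  have reach: "(u, v) \<in> (parcs G)\<^sup>*" "(v, u) \<in> (parcs G)\<^sup>*" if v: "v \<in> Domain (set c)" for v
  proof -
    obtain w where "(v, w) \<in> set c" using v by blast
    then obtain q r where c: "c = q @ (v, w) # r" by (meson split_list)
    then have "pcas u q v" "pcas v ((v, w) # r) u" using u(1) by (auto simp: pcas_append)
    moreover have "set q \<subseteq> parcs G" "set ((v, w) # r) \<subseteq> parcs G" using c u(2) by auto
    ultimately show "(u, v) \<in> (parcs G)\<^sup>*" "(v, u) \<in> (parcs G)\<^sup>*" by (blast intro: pcas_rtrancl)+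
  qed
  have e: "e \<in> Domain (set c)" using assms(2) by (simp add: Domain_fst)
  have "f \<in> Domain (set c)" if "(e, f) \<in> (parcs G)\<^sup>*" for f
    using that
  proof induction
    case (step f g)
    then obtain h where "(f, h) \<in> set c" by auto
    then have "h = g" using step(2) u(2) assms(3) by (meson in_mono single_valuedD)
    then show ?case using \<open>(f, h) \<in> set c\<close> DR by auto
  qed (use e in simp)
  moreover have "(e, f) \<in> (parcs G)\<^sup>*" if "f \<in> Domain (set c)" for f
    using reach(2)[OF e] reach(1)[OF that] by (rule rtrancl_trans)
  ultimately have "Domain (set c) = (parcs G)\<^sup>* `` {e}" by blast
  then show ?thesis by (simp add: Domain_fst)
qed

text \<open>The forward orbit of \<open>e\<close> is a finite closed set, so \<open>e\<close> has a
  predecessor inside its own orbit, and following arcs from \<open>e\<close> returns to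
  \<open>e\<close>.\<close>

lemma (in pair_wf_digraph) cycle_through_closed:
  assumes "finite X" "X \<subseteq> pverts G" "single_valued (parcs G)" "single_valued ((parcs G)\<inverse>)"
    and cl: "\<And>e. e \<in> X \<Longrightarrow> \<exists>f\<in>X. (e, f) \<in> parcs G" and "e \<in> X"
  obtains c where "cycle c" "e \<in> fst ` set c" "fst ` set c \<subseteq> X"
proof -
  have in_X: "f \<in> X" if "(d, f) \<in> (parcs G)\<^sup>*" "d \<in> X" for d f
    using that
  proof induction
    case (step f g)
    then show ?case using cl[of f] assms(3) by (metis single_valuedD)
  qed
  obtain d where d: "d \<in> X" "(e, d) \<in> parcs G" using cl \<open>e \<in> X\<close> by auto
  let ?Z = "(parcs G)\<^sup>* `` {e}"
  have Z: "?Z \<subseteq> X" using in_X \<open>e \<in> X\<close> by auto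
  have "\<exists>f\<in>?Z. (f, e) \<in> parcs G"
  proof (rule closed_under_injection_backward[OF _ assms(3,4)])
    show "finite ?Z" using Z assms(1) finite_subset by blast
    show "\<exists>g\<in>?Z. (f, g) \<in> parcs G" if "f \<in> ?Z" for f
      using that Z cl[of f] by (meson Image_singleton_iff in_mono rtrancl.rtrancl_into_rtrancl)
  qed simp
  then obtain f where f: "(e, f) \<in> (parcs G)\<^sup>*" "(f, e) \<in> parcs G" by auto
  \<comment> \<open>By uniqueness of successors the first step from \<open>e\<close> towards
    \<open>f\<close> goes to \<open>d\<close>. If \<open>e = f\<close>, the arc is a loop and
    \<open>d = e\<close>.\<close>
  have "(d, e) \<in> (parcs G)\<^sup>*"
  proof (cases "e = f")
    case True
    then have "d = e" using d(2) f(2) assms(3) by (metis single_valuedD)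
    then show ?thesis by simp
  next
    case False
    then obtain d' where "(e, d') \<in> parcs G" "(d', f) \<in> (parcs G)\<^sup>*"
      using f(1) by (meson converse_rtranclE)
    then show ?thesis using d(2) f(2) assms(3) by (metis rtrancl.rtrancl_into_rtrancl single_valuedD)
  qed
  moreover have "d \<in> pverts G" using d assms(2) by auto
  ultimately obtain p where p: "apath d p e"
    by (metis apath_Nil_iff apath_awalk_to_apath reachable1_awalk rtranclD)
  then have aw: "awalk d p e" "distinct (pawalk_verts d p)" by (auto simp: apath_def)
  \<comment> \<open>A cycle requires distinct vertices only after the first one, and these are the
    vertices of the path \<open>p\<close>.\<close>
  have "cycle ((e, d) # p)" unfolding cycle_def
    using aw d assms(2) \<open>e \<in> X\<close> by (intro exI[of _ e]) (auto simp: awalk_Cons_iff)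
  moreover from this have "fst ` set ((e, d) # p) \<subseteq> X"
    using cycle_tails_eq_reachable[of "(e, d) # p" e] Z assms(3) by auto
  ultimately show thesis by (intro that[of "(e, d) # p"]) auto
qed

text \<open>Supports are nonempty and pairwise disjoint, so a union determines its members; a closed
  set is the union of the supports it contains because each of its elements lies on such a
  cycle.\<close>

lemma (in pair_wf_digraph) Union_cycle_supports:
  assumes "finite (pverts G)" "single_valued (parcs G)" "single_valued ((parcs G)\<inverse>)"
  shows "bij_betw Union (Pow {fst ` set c | c. cycle c})
    {X. X \<subseteq> pverts G \<and> (\<forall>e\<in>X. \<exists>f\<in>X. (e, f) \<in> parcs G)}"
proof -
  define C where "C = {fst ` set c | c. cycle c}"
  let ?F = "{X. X \<subseteq> pverts G \<and> (\<forall>e\<in>X. \<exists>f\<in>X. (e, f) \<in> parcs G)}"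
  have reach: "U = (parcs G)\<^sup>* `` {e}" if "U \<in> C" "e \<in> U" for U e
    using that cycle_tails_eq_reachable assms(2) unfolding C_def by blast
  have ne: "U \<noteq> {}" if "U \<in> C" for U
    using that by (auto simp: C_def cycle_def)
  have closed: "U \<in> ?F" if U: "U \<in> C" for U
  proof -
    obtain c where c: "cycle c" "U = fst ` set c" using U unfolding C_def by auto
    then have *: "set c \<subseteq> parcs G" by (auto simp: cycle_def awalk_def)
    have "\<exists>f\<in>U. (e, f) \<in> parcs G" if e: "e \<in> U" for e
    proof -
      have "e \<in> Domain (parcs G)" using e c(2) * by (auto simp: Domain_fst)
      then obtain f where "(e, f) \<in> parcs G" by auto
      then show ?thesis using reach[OF U e] by (metis Image_singleton_iff r_into_rtrancl)
    qed
    moreover have "U \<subseteq> pverts G" using c(2) * arc_fst_in_verts by blast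
    ultimately show ?thesis by auto
  qed
  show ?thesis unfolding bij_betw_def C_def[symmetric]
  proof
    have sub: "Y \<subseteq> Z" if YZ: "Y \<subseteq> C" "Z \<subseteq> C" "\<Union> Y = \<Union> Z" for Y Z
    proof
      fix U assume "U \<in> Y"
      then obtain e where "e \<in> U" using ne YZ(1) by blast
      then obtain V where "V \<in> Z" "e \<in> V" using \<open>U \<in> Y\<close> YZ(3) by blast
      then have "U = V" using reach YZ(1,2) \<open>U \<in> Y\<close> \<open>e \<in> U\<close> by (metis in_mono)
      then show "U \<in> Z" using \<open>V \<in> Z\<close> by simp
    qed
    show "inj_on Union (Pow C)"
    proof (rule inj_onI)
      fix Y Z assume YZ: "Y \<in> Pow C" "Z \<in> Pow C" "\<Union> Y = \<Union> Z"
      from YZ have "Y \<subseteq> C" "Z \<subseteq> C" by simp_all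
      with YZ(3) sub[of Y Z] sub[of Z Y] show "Y = Z" by simp
    qed
    show "Union ` Pow C = ?F"
    proof
      show "Union ` Pow C \<subseteq> ?F"
      proof
        fix X assume "X \<in> Union ` Pow C"
        then obtain Y where Y: "X = \<Union> Y" "Y \<in> Pow C" by (rule imageE)
        then have "\<And>U. U \<in> Y \<Longrightarrow> U \<in> ?F" using closed by (meson PowD subsetD)
        then show "X \<in> ?F" unfolding Y(1) by blast
      qed
      show "?F \<subseteq> Union ` Pow C"
      proof
        fix X assume "X \<in> ?F"
        then have X: "X \<subseteq> pverts G" "\<And>e. e \<in> X \<Longrightarrow> \<exists>f\<in>X. (e, f) \<in> parcs G" by simp_all
        then have "finite X" using assms(1) finite_subset by metis
        have "X = \<Union> {U \<in> C. U \<subseteq> X}"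
        proof (intro equalityI subsetI)
          fix e assume "e \<in> X"
          obtain c where "cycle c" "e \<in> fst ` set c" "fst ` set c \<subseteq> X"
            using cycle_through_closed[OF \<open>finite X\<close> X(1) assms(2,3) X(2) \<open>e \<in> X\<close>] by metis
          moreover from this have "fst ` set c \<in> C"
            unfolding C_def by (intro CollectI exI[of _ c]) simp
          ultimately show "e \<in> \<Union> {U \<in> C. U \<subseteq> X}"
            by (intro UnionI[of "fst ` set c"]) simp_all
        next
          fix e assume "e \<in> \<Union> {U \<in> C. U \<subseteq> X}"
          then show "e \<in> X" by (elim UnionE) (simp add: subset_eq)
        qed
        then show "X \<in> Union ` Pow C" by (rule image_eqI) simp
      qed
    qed
  qed
qed

section \<open>Monomials\<close>

lemma prod_Var: "(\<Prod>i\<in>I. Var (f i)) = Poly_Mapping.single (\<Sum>i\<in>I. Poly_Mapping.single (f i) 1) 1"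
  by (induction I rule: infinite_finite_induct) (simp_all add: Var_def mult_single)

lemma lookup_sum_single:
  assumes "finite I" "inj_on f I"
  shows "Poly_Mapping.lookup (\<Sum>i\<in>I. Poly_Mapping.single (f i) (1 :: nat)) x = of_bool (x \<in> f ` I)"
proof -
  have "Poly_Mapping.lookup (\<Sum>i\<in>I. Poly_Mapping.single (f i) (1 :: nat)) x
      = (\<Sum>i\<in>I. if f i = x then 1 else 0)"
    by (simp add: lookup_sum lookup_single when_def cong: if_cong)
  also have "\<dots> = card {i \<in> I. f i = x}" using assms(1) by (simp add: sum.If_cases Int_def)
  also have "\<dots> = of_bool (x \<in> f ` I)"
  proof (cases "x \<in> f ` I")
    case True
    then obtain i where "i \<in> I" "x = f i" by auto
    then have "{i \<in> I. f i = x} = {i}" using assms(2) by (auto dest: inj_onD)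
    then show ?thesis using True by simp
  next
    case False
    then have none: "{i \<in> I. f i = x} = {}" by auto
    show ?thesis using False unfolding none by simp
  qed
  finally show ?thesis .
qed

definition flow_monomial :: "'a set \<Rightarrow> 'a rel \<Rightarrow> 'a rel \<Rightarrow> 'a trek_poly" where
  "flow_monomial S L R =
     (\<Prod>s\<in>S. Var (Omega s)) * (\<Prod>(x, y)\<in>L. Var (Lambda x y)) * (\<Prod>(x, y)\<in>R. Var (Lambda x y))"

text \<open>Compare exponents: that of \<open>Omega s\<close> tells whether \<open>s\<close> is in
  \<open>S\<close>, and that of \<open>Lambda x y\<close> counts the sides containing the edge. The
  count is 2 on the intersection and positive on the union.\<close>

lemma flow_monomial_eq_iff:
  fixes S S' :: "'a set" and L L' R R' :: "'a rel"
  assumes "finite S" "finite L" "finite R" "finite S'" "finite L'" "finite R'"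
  shows "flow_monomial S L R = flow_monomial S' L' R' \<longleftrightarrow>
     S = S' \<and> L \<inter> R = L' \<inter> R' \<and> L \<union> R = L' \<union> R'"
proof -
  define lam :: "'a \<times> 'a \<Rightarrow> 'a indet" where "lam = (\<lambda>(x, y). Lambda x y)"
  define ex :: "'a set \<Rightarrow> 'a rel \<Rightarrow> 'a rel \<Rightarrow> 'a indet \<Rightarrow>\<^sub>0 nat" where
    "ex S L R = (\<Sum>s\<in>S. Poly_Mapping.single (Omega s) 1) + (\<Sum>e\<in>L. Poly_Mapping.single (lam e) 1)
       + (\<Sum>e\<in>R. Poly_Mapping.single (lam e) 1)" for S L R
  have fm: "flow_monomial S L R = Poly_Mapping.single (ex S L R) 1" for S L R
    by (simp add: flow_monomial_def ex_def prod_Var mult_single lam_def case_prod_unfold)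
  have inj: "inj_on Omega S" "inj_on lam L" for S :: "'a set" and L
    by (auto simp: inj_on_def lam_def)
  have mem: "Omega s \<in> Omega ` S \<longleftrightarrow> s \<in> S" "Omega s \<notin> lam ` L" "lam e \<notin> Omega ` S"
    "lam e \<in> lam ` L \<longleftrightarrow> e \<in> L" for s e S L
    by (auto simp: lam_def split: prod.splits)
  have lk: "Poly_Mapping.lookup (ex S L R) (Omega s) = of_bool (s \<in> S)"
    "Poly_Mapping.lookup (ex S L R) (lam e) = of_bool (e \<in> L) + of_bool (e \<in> R)"
    if "finite S" "finite L" "finite R" for S L R s e
    unfolding ex_def lookup_add lookup_sum_single[OF that(1) inj(1)]
      lookup_sum_single[OF that(2) inj(2)] lookup_sum_single[OF that(3) inj(2)]
    by (simp_all add: mem)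
  have range: "(\<exists>s. x = Omega s) \<or> (\<exists>e. x = lam e)" for x
    by (cases x) (auto simp: lam_def)
  have "flow_monomial S L R = flow_monomial S' L' R' \<longleftrightarrow> ex S L R = ex S' L' R'"
    unfolding fm by (metis lookup_single_eq lookup_single_not_eq zero_neq_one)
  also have "\<dots> \<longleftrightarrow> (\<forall>x. Poly_Mapping.lookup (ex S L R) x = Poly_Mapping.lookup (ex S' L' R') x)"
    by (metis poly_mapping_eqI)
  also have "\<dots> \<longleftrightarrow>
      (\<forall>s. Poly_Mapping.lookup (ex S L R) (Omega s) = Poly_Mapping.lookup (ex S' L' R') (Omega s)) \<and>
      (\<forall>e. Poly_Mapping.lookup (ex S L R) (lam e) = Poly_Mapping.lookup (ex S' L' R') (lam e))"
    using range by metis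
  also have "\<dots> \<longleftrightarrow> (\<forall>s. of_bool (s \<in> S) = (of_bool (s \<in> S') :: nat)) \<and>
      (\<forall>e. of_bool (e \<in> L) + of_bool (e \<in> R) = (of_bool (e \<in> L') + of_bool (e \<in> R') :: nat))"
    unfolding lk[OF assms(1-3)] lk[OF assms(4-6)] ..
  also have "\<dots> \<longleftrightarrow> S = S' \<and> L \<inter> R = L' \<inter> R' \<and> L \<union> R = L' \<union> R'"
  proof -
    have "of_bool (e \<in> L) + of_bool (e \<in> R) = (of_bool (e \<in> L') + of_bool (e \<in> R') :: nat) \<longleftrightarrow>
        (e \<in> L \<inter> R \<longleftrightarrow> e \<in> L' \<inter> R') \<and> (e \<in> L \<union> R \<longleftrightarrow> e \<in> L' \<union> R')" for e
      by (auto simp: of_bool_def)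
    then show ?thesis unfolding set_eq_iff by (simp only:) auto
  qed
  finally show ?thesis .
qed

lemma prod_list_paths:
  fixes f :: "'a \<times> 'a \<Rightarrow> 'b :: comm_monoid_mult"
  assumes "finite I" "\<And>i. i \<in> I \<Longrightarrow> distinct (p i)"
    and "\<And>i j. i \<in> I \<Longrightarrow> j \<in> I \<Longrightarrow> i \<noteq> j \<Longrightarrow> set (p i) \<inter> set (p j) = {}"
  shows "(\<Prod>i\<in>I. prod_list (map f (p i))) = prod f (\<Union>i\<in>I. set (p i))"
  using assms by (subst prod.UNION_disjoint) (auto simp: prod.distinct_set_conv_list intro!: prod.cong)

section \<open>Trek systems\<close>

lemma is_trek_iff:
  "is_trek G i T j \<longleftrightarrow> source T \<in> pverts G \<and> set (left_path T) \<subseteq> parcs G \<and>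
     set (right_path T) \<subseteq> parcs G \<and> pcas (source T) (left_path T) i \<and> pcas (source T) (right_path T) j"
  by (auto simp: is_trek_def pre_digraph.awalk_def cas_with_proj_eq)

text \<open>A nonempty closed walk contains a cycle.\<close>

lemma acyclic_parcs:
  assumes "pair_digraph G" "\<nexists>c. pre_digraph.cycle (with_proj G) c"
  shows "acyclic (parcs G)"
proof -
  interpret pair_digraph G by fact
  have "(u, u) \<notin> (parcs G)\<^sup>+" for u
    using assms(2) closed_w_imp_cycle by (auto simp: reachable1_awalk closed_w_def)
  then show ?thesis by (simp add: acyclic_def)
qed

lemma finite_edges:
  "finite TT \<Longrightarrow> finite (left_edges TT)" "finite TT \<Longrightarrow> finite (right_edges TT)"
  by (simp_all add: left_edges_def right_edges_def)

lemma disjoint_edges: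
  assumes "pcas u p v" "pcas u' q v'" "set (pawalk_verts u p) \<inter> set (pawalk_verts u' q) = {}"
  shows "set p \<inter> set q = {}"
  using assms(3) unfolding set_pawalk_verts_heads[OF assms(1)] set_pawalk_verts_heads[OF assms(2)]
  by auto

section \<open>A fixed trek system without sided intersection in an acyclic graph\<close>

context
  fixes G :: "'a pair_pre_digraph" and k A B TT
  assumes acyc: "acyclic (parcs G)" and TT: "trek_system G k A B TT"
    and nsi: "no_sided_intersection TT"
begin

lemma trek_paths:
  assumes "T \<in> TT"
  shows "source T \<in> pverts G" "set (left_path T) \<subseteq> parcs G" "set (right_path T) \<subseteq> parcs G"
    "pcas (source T) (left_path T) (initial_vert T)" "pcas (source T) (right_path T) (final_vert T)"
    "initial_vert T \<in> A" "final_vert T \<in> B"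
  using TT assms unfolding trek_system_def is_trek_iff by auto

lemma paths_disjoint:
  assumes "S \<in> TT" "T \<in> TT" "S \<noteq> T"
  shows "set (pawalk_verts (source S) (left_path S)) \<inter> set (pawalk_verts (source T) (left_path T)) = {}"
    "set (pawalk_verts (source S) (right_path S)) \<inter> set (pawalk_verts (source T) (right_path T)) = {}"
  using nsi assms unfolding no_sided_intersection_def left_verts_def right_verts_def by blast+

lemma finite_trek_system: "finite TT"
  using TT by (simp add: trek_system_def)

lemma left_flow: "path_flow (source ` TT) A (left_edges TT)"
proof -
  have "path_flow (source ` TT) (initial_vert ` TT) (left_edges TT)"
    unfolding left_edges_def
    by (rule path_flow_Union[OF acyc trek_paths(4,2) paths_disjoint(1)])
  then show ?thesis using TT by (simp add: trek_system_def)
qed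

lemma right_flow: "path_flow (source ` TT) B (right_edges TT)"
proof -
  have "path_flow (source ` TT) (final_vert ` TT) (right_edges TT)"
    unfolding right_edges_def
    by (rule path_flow_Union[OF acyc trek_paths(5,3) paths_disjoint(2)])
  then show ?thesis using TT by (simp add: trek_system_def)
qed

text \<open>An empty path contributes its source, which is why the sources appear beside the
  heads.\<close>

lemma Union_left_verts: "(\<Union>T\<in>TT. left_verts T) = source ` TT \<union> Range (left_edges TT)"
proof -
  have "left_verts T = insert (source T) (Range (set (left_path T)))" if "T \<in> TT" for T
    unfolding left_verts_def by (rule set_pawalk_verts_heads[OF trek_paths(4)[OF that]])
  then show ?thesis unfolding left_edges_def by auto
qed

lemma Union_right_verts: "(\<Union>T\<in>TT. right_verts T) = source ` TT \<union> Range (right_edges TT)"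
proof -
  have "right_verts T = insert (source T) (Range (set (right_path T)))" if "T \<in> TT" for T
    unfolding right_verts_def by (rule set_pawalk_verts_heads[OF trek_paths(5)[OF that]])
  then show ?thesis unfolding right_edges_def by auto
qed

text \<open>A source lies on the left path of its trek, so two treks sharing it would
  intersect.\<close>

lemma inj_on_source: "inj_on source TT"
proof (rule inj_onI)
  fix S T assume *: "S \<in> TT" "T \<in> TT" "source S = source T"
  then have "source T \<in> left_verts S" "source T \<in> left_verts T"
    using set_pawalk_verts_heads[OF trek_paths(4)] unfolding left_verts_def by (metis insertI1)+
  then show "S = T" using nsi * unfolding no_sided_intersection_def by blast
qed

text \<open>Acyclicity excludes repeated edges within a path and disjointness excludes them across
  paths of one side, so products over lists become products over sets.\<close>

lemma system_monomial_eq_flow_monomial: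
  "system_monomial TT = flow_monomial (source ` TT) (left_edges TT) (right_edges TT)"
proof -
  let ?f = "\<lambda>(x, y). Var (Lambda x y)"
  have edge_disj: "set (left_path S) \<inter> set (left_path T) = {}"
    "set (right_path S) \<inter> set (right_path T) = {}"
    if "S \<in> TT" "T \<in> TT" "S \<noteq> T" for S T
    using that disjoint_edges[OF trek_paths(4) trek_paths(4) paths_disjoint(1)]
      disjoint_edges[OF trek_paths(5) trek_paths(5) paths_disjoint(2)] by simp_all
  have "(\<Prod>T\<in>TT. prod_list (map ?f (left_path T))) = prod ?f (left_edges TT)"
    unfolding left_edges_def using edge_disj finite_trek_system
      pcas_acyclic(1)[OF acyc trek_paths(4,2)] by (intro prod_list_paths)
  moreover have "(\<Prod>T\<in>TT. prod_list (map ?f (right_path T))) = prod ?f (right_edges TT)"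
    unfolding right_edges_def using edge_disj finite_trek_system
      pcas_acyclic(1)[OF acyc trek_paths(5,3)] by (intro prod_list_paths)
  ultimately show ?thesis
    by (simp add: system_monomial_def trek_monomial_def flow_monomial_def prod.distrib
        prod.reindex[OF inj_on_source])
qed

lemma parcs_updown_digraph:
  "parcs (updown_digraph TT) = updown (source ` TT) (left_edges TT) (right_edges TT)"
proof -
  let ?L = "left_edges TT" and ?R = "right_edges TT"
  have "updown_arrow TT (a, b) (c, d) \<longleftrightarrow>
      ((a, b) \<in> ?L \<and> (c, d) \<in> ?R \<and> b = d \<and> b \<in> VR \<or>
       (a, b) \<in> ?L \<and> (c, d) \<in> ?L \<and> b = c \<and> b \<notin> VR \<or>
       (a, b) \<in> ?R \<and> (c, d) \<in> ?L \<and> a = c \<and> a \<in> VL \<or>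
       (a, b) \<in> ?R \<and> (c, d) \<in> ?R \<and> a = d \<and> a \<notin> VL)"
    if "VL = (\<Union>T\<in>TT. left_verts T)" "VR = (\<Union>T\<in>TT. right_verts T)" for a b c d VL VR
    unfolding updown_arrow.simps[of TT "(a, b)" "(c, d)"] that[symmetric] prod.inject
    by (intro arg_cong2[where f = "(\<or>)"]) blast+
  from this[OF Union_left_verts[symmetric] Union_right_verts[symmetric]] show ?thesis
    unfolding updown_digraph_def one_sided_edges_def updown_def
    by (intro set_eqI) (simp split: prod.splits)
qed

text \<open>A trek is matched with the one of the same source; both follow the same flows to the
  same targets, so their paths agree. Used in both directions, this shows that sources and edge sets
  determine the system.\<close>

lemma trek_system_subset:
  assumes TT': "trek_system G k' A B TT'" and nsi': "no_sided_intersection TT'"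
    and "source ` TT' = source ` TT"
    and "left_edges TT' = left_edges TT" "right_edges TT' = right_edges TT"
  shows "TT' \<subseteq> TT"
proof
  fix T assume T: "T \<in> TT'"
  then obtain U where U: "U \<in> TT" "source T = source U" using assms(3) by blast
  have *: "source T \<in> pverts G" "pcas (source T) (left_path T) (initial_vert T)"
    "pcas (source T) (right_path T) (final_vert T)" "initial_vert T \<in> A" "final_vert T \<in> B"
    using TT' T unfolding trek_system_def is_trek_iff by auto
  have sub: "set (left_path T) \<subseteq> left_edges TT" "set (right_path T) \<subseteq> right_edges TT"
    "set (left_path U) \<subseteq> left_edges TT" "set (right_path U) \<subseteq> right_edges TT"
    using T U(1) assms(4,5) unfolding left_edges_def right_edges_def by blast+
  have "left_path T = left_path U"
    using path_flow_path_unique[OF left_flow *(2) sub(1) *(4) _ sub(3)] trek_paths[OF U(1)] U(2)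
    by metis
  moreover have "right_path T = right_path U"
    using path_flow_path_unique[OF right_flow *(3) sub(2) *(5) _ sub(4)] trek_paths[OF U(1)] U(2)
    by metis
  ultimately have "T = U" using U(2) by (cases T; cases U) simp
  then show "T \<in> TT" using U by simp
qed

end

text \<open>Both flows start from \<open>S\<close>, so the left and the right path from each source
  can be glued there into one trek.\<close>

lemma flows_trek_system:
  assumes "acyclic (parcs G)" "finite S" "S \<subseteq> pverts G" "L \<subseteq> parcs G" "R \<subseteq> parcs G"
    "finite L" "finite R" "path_flow S A L" "path_flow S B R"
  obtains TT where "trek_system G (card S) A B TT" "no_sided_intersection TT"
    "source ` TT = S" "left_edges TT = L" "right_edges TT = R"
proof -
  have ac: "acyclic L" "acyclic R" using assms(1,4,5) acyclic_subset by blast+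
  obtain p where p: "\<forall>s\<in>S. pcas s (p s) (last (pawalk_verts s (p s)))"
    "(\<lambda>s. last (pawalk_verts s (p s))) ` S = A" "(\<Union>s\<in>S. set (p s)) = L"
    "\<forall>s\<in>S. \<forall>t\<in>S. s \<noteq> t \<longrightarrow>
      set (pawalk_verts s (p s)) \<inter> set (pawalk_verts t (p t)) = {}"
    by (rule path_flow_paths[OF assms(8,6) ac(1)])
  obtain q where q: "\<forall>s\<in>S. pcas s (q s) (last (pawalk_verts s (q s)))"
    "(\<lambda>s. last (pawalk_verts s (q s))) ` S = B" "(\<Union>s\<in>S. set (q s)) = R"
    "\<forall>s\<in>S. \<forall>t\<in>S. s \<noteq> t \<longrightarrow>
      set (pawalk_verts s (q s)) \<inter> set (pawalk_verts t (q t)) = {}"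
    by (rule path_flow_paths[OF assms(9,7) ac(2)])
  define trk where "trk s = \<lparr>source = s, left_path = p s, right_path = q s\<rparr>" for s
  have sel [simp]: "source (trk s) = s" "left_path (trk s) = p s" "right_path (trk s) = q s" for s
    by (simp_all add: trk_def)
  have "inj trk" by (metis injI sel(1))
  show thesis
  proof
    show "trek_system G (card S) A B (trk ` S)"
      unfolding trek_system_def
    proof (intro conjI ballI)
      show "finite (trk ` S)" using assms(2) by simp
      show "card (trk ` S) = card S" using \<open>inj trk\<close> by (meson card_image inj_on_subset subset_UNIV)
      show "initial_vert ` trk ` S = A" "final_vert ` trk ` S = B"
        using p(2) q(2) by (simp_all add: image_image initial_vert_def final_vert_def)
      fix T assume "T \<in> trk ` S"
      then obtain s where s: "s \<in> S" "T = trk s" by blast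
      have "set (p s) \<subseteq> parcs G" "set (q s) \<subseteq> parcs G" "s \<in> pverts G"
        using s p(3) q(3) assms(3-5) by blast+
      then show "is_trek G (initial_vert T) T (final_vert T)"
        using p(1) q(1) s
        by (simp add: is_trek_iff initial_vert_def final_vert_def)
    qed
    show "no_sided_intersection (trk ` S)"
      unfolding no_sided_intersection_def left_verts_def right_verts_def
    proof (intro ballI impI)
      fix T U assume "T \<in> trk ` S" "U \<in> trk ` S" "T \<noteq> U"
      then obtain s t where "s \<in> S" "t \<in> S" "s \<noteq> t" "T = trk s" "U = trk t" by blast
      then show "set (pawalk_verts (source T) (left_path T)) \<inter> set (pawalk_verts (source U) (left_path U)) = {} \<and>
          set (pawalk_verts (source T) (right_path T)) \<inter> set (pawalk_verts (source U) (right_path U)) = {}"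
        using p(4) q(4) by simp
    qed
    show "source ` trk ` S = S" by (simp add: image_image)
    show "left_edges (trk ` S) = L" "right_edges (trk ` S) = R"
      using p(3) q(3) by (simp_all add: left_edges_def right_edges_def)
  qed
qed

section \<open>The counting bijection\<close>

theorem theorem3p4:
  fixes G :: "'a pair_pre_digraph"
    and A B :: "'a set"
    and rA rB :: "'a rel"
    and k :: nat
    and TT :: "'a trek set"
  assumes "pair_digraph G"
    and "\<nexists>c. pre_digraph.cycle (with_proj G) c"
    and "A \<subseteq> pverts G" and "B \<subseteq> pverts G"
    and "card A = k" and "card B = k"
    and "linear_order_on A rA" and "linear_order_on B rB"
    and "trek_system G k A B TT"
    and "no_sided_intersection TT"
  shows "card {TT'. trek_system G k A B TT' \<and> no_sided_intersection TT' \<and>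
                    system_monomial TT' = system_monomial TT}
         = 2 ^ card (UD TT)"
proof -
  note acyc = acyclic_parcs[OF assms(1,2)]
  note TT = assms(9,10)
  define S L R where SLR: "S = source ` TT" "L = left_edges TT" "R = right_edges TT"
  let ?E = "L \<union> R - L \<inter> R"
  have flow: "path_flow S A L" "path_flow S B R"
    using left_flow[OF acyc TT] right_flow[OF acyc TT] unfolding SLR .
  have fin: "finite TT" "finite S" "finite L" "finite R"
    using finite_trek_system[OF acyc TT] finite_edges unfolding SLR by auto
  have LR: "S \<subseteq> pverts G" "L \<subseteq> parcs G" "R \<subseteq> parcs G"
    using trek_paths[OF acyc TT] unfolding SLR left_edges_def right_edges_def by blast+
  \<comment> \<open>Systems rebuilt from flows have one trek per source, hence again
    \<open>k\<close> treks.\<close>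
  have "card S = k"
    using TT(1) card_image[OF inj_on_source[OF acyc TT]] unfolding SLR by (simp add: trek_system_def)
  define M where "M = {TT'. trek_system G k A B TT' \<and> no_sided_intersection TT' \<and>
                    system_monomial TT' = system_monomial TT}"
  define F where "F = {X. X \<subseteq> ?E \<and> (\<forall>e\<in>X. \<exists>f\<in>X. (e, f) \<in> updown S L R)}"
  have M_iff: "TT' \<in> M \<longleftrightarrow> trek_system G k A B TT' \<and> no_sided_intersection TT' \<and> source ` TT' = S \<and>
      left_edges TT' \<inter> right_edges TT' = L \<inter> R \<and> left_edges TT' \<union> right_edges TT' = L \<union> R" for TT'
  proof (cases "trek_system G k A B TT' \<and> no_sided_intersection TT'")
    case True
    then have T': "trek_system G k A B TT'" "no_sided_intersection TT'" by auto
    have fin': "finite (source ` TT')" "finite (left_edges TT')" "finite (right_edges TT')"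
      using finite_trek_system[OF acyc T'] finite_edges by auto
    show ?thesis
      unfolding M_def mem_Collect_eq system_monomial_eq_flow_monomial[OF acyc T']
        system_monomial_eq_flow_monomial[OF acyc TT] SLR[symmetric]
        flow_monomial_eq_iff[OF fin' fin(2-4)] using T' by simp
  qed (auto simp: M_def)
  have sv: "single_valued (updown S L R)" "single_valued ((updown S L R)\<inverse>)"
    using single_valued_updown[OF flow] single_valued_updown[OF flow(2,1)] updown_converse[OF flow]
    by simp_all
  \<comment> \<open>The set of edges that change sides. Only the left sides are compared, since
    union and intersection then fix the right side.\<close>
  define \<Phi> where "\<Phi> TT' = (L - left_edges TT') \<union> (left_edges TT' - L)" for TT'
  have "bij_betw \<Phi> M F"
    unfolding bij_betw_def
  proof
    show "inj_on \<Phi> M"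
    proof (rule inj_onI)
      fix T U assume TU: "T \<in> M" "U \<in> M" "\<Phi> T = \<Phi> U"
      note T = TU(1)[unfolded M_iff] and U = TU(2)[unfolded M_iff]
      have l: "left_edges T = left_edges U" using TU(3) unfolding \<Phi>_def by blast
      have "right_edges V = (left_edges V \<union> right_edges V - left_edges V) \<union> (left_edges V \<inter> right_edges V)"
        for V :: "'a trek set" by blast
      from this[of T] this[of U] have r: "right_edges T = right_edges U" using T U l by simp
      have T': "trek_system G k A B T" "no_sided_intersection T" "source ` T = S"
        and U': "trek_system G k A B U" "no_sided_intersection U" "source ` U = S"
        using T U by blast+
      show "T = U"
      proof
        show "T \<subseteq> U"
          by (rule trek_system_subset[OF acyc U'(1,2) T'(1,2) _ l r]) (simp only: T'(3) U'(3))
        show "U \<subseteq> T"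
          by (rule trek_system_subset[OF acyc T'(1,2) U'(1,2) _ l[symmetric] r[symmetric]])
            (simp only: T'(3) U'(3))
      qed
    qed
    show "\<Phi> ` M = F"
    proof (intro equalityI subsetI)
      fix X assume "X \<in> \<Phi> ` M"
      then obtain T where T: "T \<in> M" "X = \<Phi> T" by auto
      note T' = T(1)[unfolded M_iff]
      have fl: "path_flow S A (left_edges T)" "path_flow S B (right_edges T)"
        using left_flow[OF acyc, of k A B T] right_flow[OF acyc, of k A B T] T' by simp_all
      have "\<exists>f\<in>X. (e, f) \<in> updown S L R" if "e \<in> X" for e
        unfolding T(2) \<Phi>_def
        by (rule flip_forward[OF flow fl]) (use T' that T(2) in \<open>simp_all add: \<Phi>_def\<close>)
      moreover have "left_edges T \<inter> right_edges T = L \<inter> R" "left_edges T \<union> right_edges T = L \<union> R"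
        using T' by simp_all
      then have "X \<subseteq> ?E" unfolding T(2) \<Phi>_def by blast
      ultimately show "X \<in> F" unfolding F_def by simp
    next
      fix X assume "X \<in> F"
      then have X: "X \<subseteq> ?E" "\<forall>e\<in>X. \<exists>f\<in>X. (e, f) \<in> updown S L R" unfolding F_def by auto
      have "finite X" using X(1) fin(3,4) by (meson finite_Diff finite_UnI finite_subset)
      \<comment> \<open>Finiteness and injectivity of the successor relation turn forward closure
        into backward closure.\<close>
      have bw: "\<forall>f\<in>X. \<exists>e\<in>X. (e, f) \<in> updown S L R"
        using closed_under_injection_backward[OF \<open>finite X\<close> sv] X(2) by blast
      have conv: "(f, e) \<in> updown S R L" if "(e, f) \<in> updown S L R" for e f
        using that updown_converse[OF flow] by blast
      let ?L = "(L - X) \<union> (R \<inter> X)" and ?R = "(R - X) \<union> (L \<inter> X)"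
      have "path_flow S A ?L" by (rule path_flow_flip[OF flow X bw])
      \<comment> \<open>With the sides exchanged the arrows reverse, so the forward and backward
        closure of \<open>X\<close> trade places.\<close>
      moreover have "path_flow S B ?R"
      proof (rule path_flow_flip[OF flow(2,1)])
        show "X \<subseteq> R \<union> L - R \<inter> L" using X(1) by blast
        show "\<forall>e\<in>X. \<exists>f\<in>X. (e, f) \<in> updown S R L" using bw conv by blast
        show "\<forall>f\<in>X. \<exists>e\<in>X. (e, f) \<in> updown S R L" using X(2) conv by blast
      qed
      moreover have "?L \<subseteq> parcs G" "?R \<subseteq> parcs G" "finite ?L" "finite ?R" using LR fin by auto
      ultimately obtain T where T: "trek_system G k A B T" "no_sided_intersection T"
        "source ` T = S" "left_edges T = ?L" "right_edges T = ?R"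
        using flows_trek_system[OF acyc fin(2) LR(1), of ?L ?R A B] \<open>card S = k\<close> by metis
      have "?L \<inter> ?R = L \<inter> R" "?L \<union> ?R = L \<union> R" using X(1) by blast+
      then have "T \<in> M" unfolding M_iff using T by simp
      moreover have "X = \<Phi> T" unfolding \<Phi>_def T(4) using X(1) by auto
      ultimately show "X \<in> \<Phi> ` M" by blast
    qed
  qed
  moreover have "bij_betw Union (Pow (UD TT)) F"
  proof -
    interpret U: pair_wf_digraph "updown_digraph TT"
      by unfold_locales (auto simp: updown_digraph_def)
    have pv: "pverts (updown_digraph TT) = ?E"
      by (simp add: updown_digraph_def one_sided_edges_def SLR)
    have pa: "parcs (updown_digraph TT) = updown S L R"
      unfolding SLR by (rule parcs_updown_digraph[OF acyc TT])
    show ?thesis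
      using U.Union_cycle_supports fin sv unfolding pv pa F_def UD_def by simp
  qed
  ultimately have "card M = card (Pow (UD TT))"
    by (metis bij_betw_same_card)
  \<comment> \<open>Since \<open>card\<close> is 0 on infinite sets, finiteness is required to
    evaluate the cardinality of the power set.\<close>
  moreover have "finite (UD TT)"
  proof -
    have "UD TT \<subseteq> Pow (left_edges TT \<union> right_edges TT)"
      unfolding UD_def pre_digraph.cycle_def pre_digraph.awalk_def
      by (auto simp: updown_digraph_def one_sided_edges_def)
    then show ?thesis using fin unfolding SLR by (meson finite_Pow_iff finite_UnI finite_subset)
  qed
  ultimately show ?thesis unfolding M_def by (simp add: card_Pow)
qed

end
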